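(* Let $\phi\in\mathbb{R}$ be a rational multiple of $\pi$ and let $\vec{k}_1,\vec{k}_2\in\mathbb{R}^3$ be orthogonal unit vectors. (i) If $\phi\notin\{\frac{k\pi}{2}:k\in\mathbb{Z}\}$, then the product $O(\phi,\vec{k}_1)O(\phi,\vec{k}_2)\in SO(3)$ is a rotation $O(\gamma,\vec{k})$ about some axis $\vec{k}$ by an angle $\gamma$ which is an irrational multiple of $\pi$ (i.e. $\gamma/\pi\notin\mathbb{Q}$). (ii) The set $\langle O(\phi,\vec{k}_1),O(\phi,\vec{k}_2)\rangle\subset SO(3)$ is infinite if and only if $\phi\notin\{\frac{k\pi}{2}:k\in\mathbb{Z}\}$; likewise, the set $\langle U(\frac{\phi}{2},\vec{k}_1),U(\frac{\phi}{2},\vec{k}_2)\rangle\subset SU(2)$ generated by the corresponding unitary matrices is infinite if and only if $\phi\notin\{\frac{k\pi}{2}:k\in\mathbb{Z}\}$.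
   Context: For a unit vector $\vec{k}\in\mathbb{R}^3$ and $\phi\in\mathbb{R}$, $O(\phi,\vec{k})\in SO(3)$ is the rotation by the angle $\phi$ about the axis $\vec{k}$, i.e. $O(\phi,\vec{k})v=\cos\phi\, v+\sin\phi\,(\vec{k}\times v)+(1-\cos\phi)(\vec{k}\cdot v)\vec{k}$. The corresponding $SU(2)$ matrix, for $\vec{k}=[k_x,k_y,k_z]$, is $U(\frac{\phi}{2},\vec{k})=\cos\frac{\phi}{2}\,I+\sin\frac{\phi}{2}\,(k_xX+k_yY+k_zZ)$ with $X=\begin{pmatrix}0&1\\-1&0\end{pmatrix}$, $Y=\begin{pmatrix}0&i\\i&0\end{pmatrix}$, $Z=\begin{pmatrix}i&0\\0&-i\end{pmatrix}$; it maps to $O(\phi,\vec{k})$ under the double cover $SU(2)\to SO(3)$. For a finite subset $\mathcal{S}$ of a group, the set generated by $\mathcal{S}$, denoted $\langle\mathcal{S}\rangle$, is the set of all words (finite products) $g_{1}^{k_1}\cdots g_{m}^{k_m}$ with $g_{j}\in\mathcal{S}$ and $k_j\in\mathbb{N}$. A rational multiple of $\pi$ is a number $a\pi$ with $a\in\mathbb{Q}$. *)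

theory Defs
  imports "HOL-Analysis.Analysis" "HOL-Algebra.Group"
begin

definition SO3 :: "(real^3^3) monoid" where
  "SO3 = \<lparr>carrier = {A. rotation_matrix A}, mult = (**), one = mat 1\<rparr>"

definition conj_transpose :: "complex^'n^'m \<Rightarrow> complex^'m^'n" where
  "conj_transpose A = (\<chi> i j. cnj (A $ j $ i))"

definition SU2 :: "(complex^2^2) monoid" where
  "SU2 = \<lparr>carrier = {A. conj_transpose A ** A = mat 1 \<and> det A = 1}, mult = (**), one = mat 1\<rparr>"

text \<open>Products of powers with exponents in \<open>\<nat>\<close>: unlike \<open>generate\<close> of
  \<open>HOL-Algebra\<close>, inverses of the generators are not adjoined.\<close>

definition words :: "('a, 'b) monoid_scheme \<Rightarrow> 'a set \<Rightarrow> 'a set" where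
  "words G S = {foldr (\<lambda>(g, k) h. (g [^]\<^bsub>G\<^esub> k) \<otimes>\<^bsub>G\<^esub> h) w \<one>\<^bsub>G\<^esub> |
                 w :: ('a \<times> nat) list. \<forall>(g, k) \<in> set w. g \<in> S}"

text \<open>The matrix, in the standard basis, of the rotation by the angle \<open>\<phi>\<close> about the
  axis \<open>k\<close> (meaningful for \<open>norm k = 1\<close>).\<close>

definition rotation :: "real \<Rightarrow> real^3 \<Rightarrow> real^3^3" where
  "rotation \<phi> k =
     matrix (\<lambda>v. cos \<phi> *\<^sub>R v + sin \<phi> *\<^sub>R cross3 k v + ((1 - cos \<phi>) * (k \<bullet> v)) *\<^sub>R k)"

definition matX :: "complex^2^2" where
  "matX = vector [vector [0, 1], vector [-1, 0]]"

definition matY :: "complex^2^2" where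
  "matY = vector [vector [0, \<i>], vector [\<i>, 0]]"

definition matZ :: "complex^2^2" where
  "matZ = vector [vector [\<i>, 0], vector [0, -\<i>]]"

text \<open>The first argument is half of the angle of the rotation covered by this matrix.\<close>

definition su2_rotation :: "real \<Rightarrow> real^3 \<Rightarrow> complex^2^2" where
  "su2_rotation \<theta> k =
     cos \<theta> *\<^sub>R mat 1 + sin \<theta> *\<^sub>R (k $ 1 *\<^sub>R matX + k $ 2 *\<^sub>R matY + k $ 3 *\<^sub>R matZ)"

lemma rotation_mult_vec:
  "rotation \<phi> k *v v = cos \<phi> *\<^sub>R v + sin \<phi> *\<^sub>R cross3 k v + ((1 - cos \<phi>) * (k \<bullet> v)) *\<^sub>R k"
proof -
  have "linear (\<lambda>v. cos \<phi> *\<^sub>R v + sin \<phi> *\<^sub>R cross3 k v + ((1 - cos \<phi>) * (k \<bullet> v)) *\<^sub>R k)"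
    by (rule linearI) (simp_all add: cross_add_right cross_mult_right inner_right_distrib algebra_simps)
  then show ?thesis
    by (simp add: rotation_def matrix_works linear_matrix_vector_mul_eq)
qed

lemma group_SO3: "group SO3"
proof (rule groupI)
  fix A assume "A \<in> carrier SO3"
  then show "\<exists>B\<in>carrier SO3. B \<otimes>\<^bsub>SO3\<^esub> A = \<one>\<^bsub>SO3\<^esub>"
    by (intro bexI[of _ "transpose A"]) (auto simp: SO3_def rotation_matrix_def orthogonal_matrix_def det_transpose)
qed (auto simp: SO3_def rotation_matrix_def orthogonal_matrix_mul orthogonal_matrix_id det_mul matrix_mul_assoc)

lemma conj_transpose_mul: "conj_transpose (A ** B) = conj_transpose B ** conj_transpose A"
  by (simp add: conj_transpose_def matrix_matrix_mult_def vec_eq_iff mult.commute)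

lemma group_SU2: "group SU2"
proof (rule groupI)
  fix A B assume "A \<in> carrier SU2" "B \<in> carrier SU2"
  then have A: "conj_transpose A ** A = mat 1" "det A = 1"
    and B: "conj_transpose B ** B = mat 1" "det B = 1"
    by (auto simp: SU2_def)
  have "conj_transpose (A ** B) ** (A ** B) = conj_transpose B ** (conj_transpose A ** A) ** B"
    by (simp add: conj_transpose_mul matrix_mul_assoc)
  with A B show "A \<otimes>\<^bsub>SU2\<^esub> B \<in> carrier SU2"
    by (simp add: SU2_def det_mul)
next
  fix A assume "A \<in> carrier SU2"
  then have A: "conj_transpose A ** A = mat 1" "det A = 1"
    by (auto simp: SU2_def)
  have "det (conj_transpose A) * det A = 1"
    using A(1) by (metis det_mul det_I)
  moreover have "conj_transpose (conj_transpose A) = A"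
    by (simp add: conj_transpose_def vec_eq_iff)
  moreover have "A ** conj_transpose A = mat 1"
    using A(1) matrix_left_right_inverse by blast
  ultimately show "\<exists>B\<in>carrier SU2. B \<otimes>\<^bsub>SU2\<^esub> A = \<one>\<^bsub>SU2\<^esub>"
    using A by (intro bexI[of _ "conj_transpose A"]) (auto simp: SU2_def)
next
  show "\<one>\<^bsub>SU2\<^esub> \<in> carrier SU2"
    by (simp add: SU2_def) (simp add: conj_transpose_def mat_def vec_eq_iff matrix_matrix_mult_def
        if_distrib cong: if_cong)
qed (auto simp: SU2_def matrix_mul_assoc)

end

theory Submission
  imports Defs
begin

text \<open>A rotation is covered by a unit quaternion \<open>(cos \<theta>, sin \<theta> k)\<close>, where \<open>\<theta>\<close> is half of the angle. The
  product of the two generating quaternions has real part \<open>cos\<^sup>2 (\<phi>/2)\<close>, since the axes are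
  orthogonal, so \<open>cos \<phi> = 2 cos \<theta> - 1\<close>. If \<open>\<phi>\<close> and \<open>\<theta>\<close> were both rational multiples of \<open>\<pi>\<close>, then
  \<open>cos \<phi>\<close> would lie in \<open>\<int>[\<omega>]\<close> for a root of unity \<open>\<omega>\<close>, and so would the sequence
  \<open>c\<^sub>n = cos (2\<^sup>n \<phi>)\<close>, which takes some value twice. As
  \<open>c\<^sub>n\<^sub>+\<^sub>1 - 1 = 2 (c\<^sub>n - 1) (c\<^sub>n + 1)\<close> and \<open>1/2\<close> is not in \<open>\<int>[\<omega>]\<close>, the repeated value must be 1.
  Going back along \<open>c\<^sub>n\<^sub>+\<^sub>1 = 2 c\<^sub>n\<^sup>2 - 1\<close> one never leaves \<open>{0, 1, -1}\<close>, because \<open>c\<^sub>n\<^sup>2 = 1/2\<close> is excluded.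
  Hence \<open>\<phi>\<close> is a multiple of \<open>\<pi>/2\<close>. In that case all words stay in the binary octahedral group.\<close>

section \<open>Roots of unity and rational angles\<close>

text \<open>An indexed family instead of a set of generators, so that an induction on
  \<open>n\<close> can eliminate the last one.\<close>

definition int_span :: "(nat \<Rightarrow> 'a::ring_1) \<Rightarrow> nat \<Rightarrow> 'a set" where
  "int_span v n = {\<Sum>i<n. of_int (a i) * v i | a. True}"

lemma int_span_0 [simp]: "0 \<in> int_span v n"
  unfolding int_span_def by (auto intro!: exI[of _ "\<lambda>_. 0"])

lemma int_span_add: "x \<in> int_span v n \<Longrightarrow> y \<in> int_span v n \<Longrightarrow> x + y \<in> int_span v n"
proof -
  assume "x \<in> int_span v n" "y \<in> int_span v n"
  then obtain a b where "x = (\<Sum>i<n. of_int (a i) * v i)" "y = (\<Sum>i<n. of_int (b i) * v i)"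
    by (auto simp: int_span_def)
  then have "x + y = (\<Sum>i<n. of_int (a i + b i) * v i)"
    by (simp add: sum.distrib distrib_right)
  then show ?thesis
    by (auto simp: int_span_def intro: exI[of _ "\<lambda>i. a i + b i"])
qed

lemma int_span_of_int_mult:
  assumes "x \<in> int_span v n" shows "of_int m * x \<in> int_span v n"
proof -
  from assms obtain a where "x = (\<Sum>i<n. of_int (a i) * v i)"
    by (auto simp: int_span_def)
  then have "of_int m * x = (\<Sum>i<n. of_int (m * a i) * v i)"
    by (simp add: sum_distrib_left mult.assoc)
  then show ?thesis
    by (auto simp: int_span_def intro: exI[of _ "\<lambda>i. m * a i"])
qed

lemma int_span_sum: "(\<And>i. i \<in> I \<Longrightarrow> f i \<in> int_span v n) \<Longrightarrow> sum f I \<in> int_span v n"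
  by (induction I rule: infinite_finite_induct) (auto intro: int_span_add)

lemma int_span_gen:
  assumes "j < n" shows "v j \<in> int_span v n"
proof -
  have "(\<Sum>i<n. of_int (if i = j then 1 else 0) * v i) = (\<Sum>i<n. if i = j then v i else 0)"
    by (intro sum.cong) auto
  also have "\<dots> = v j"
    using assms by simp
  finally show ?thesis
    unfolding int_span_def by (intro CollectI exI[of _ "\<lambda>i. if i = j then 1 else 0"]) simp
qed

text \<open>A form of Nakayama's lemma at the prime 2, by eliminating one generator at a time.\<close>

lemma generators_zero_if_two_divisible:
  fixes v :: "nat \<Rightarrow> 'a::{idom,ring_char_0}"
  assumes "\<And>i. i < n \<Longrightarrow> \<exists>u. odd u \<and> (\<exists>x\<in>int_span v n. of_int u * v i = 2 * x)"
  shows "i < n \<Longrightarrow> v i = 0"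
  using assms
proof (induction n arbitrary: i)
  case (Suc n)
  from Suc.prems(2)[of n] obtain u a where "odd u"
    and "of_int u * v n = 2 * (\<Sum>i<Suc n. of_int (a i) * v i)"
    by (auto simp: int_span_def)
  \<comment> \<open>Moving the \<open>v n\<close> term to the left changes its coefficient by an
    even number, so \<open>w\<close> is odd and in particular nonzero. Allowing odd factors on the
    left plays the role of localising at 2.\<close>
  moreover define w s where "w = u - 2 * a n" and "s = (\<Sum>i<n. of_int (a i) * v i)"
  ultimately have w: "odd w" "of_int w * v n = 2 * s"
    by (auto simp: algebra_simps)
  have s: "s \<in> int_span v n"
    by (auto simp: s_def int_span_def)
  have zero: "v j = 0" if "j < n" for j
  proof (rule Suc.IH[OF that])
    fix i assume "i < n"
    with Suc.prems(2)[of i] obtain t b where t: "odd t"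
      "of_int t * v i = 2 * (\<Sum>i<Suc n. of_int (b i) * v i)"
      by (auto simp: int_span_def)
    define r where "r = (\<Sum>i<n. of_int (b i) * v i)"
    \<comment> \<open>The factor \<open>w\<close> lets \<open>w * v n\<close> be replaced by
      \<open>2 * s\<close>, which involves only the first \<open>n\<close> generators;
      \<open>w * t\<close> is again odd.\<close>
    have "of_int (w * t) * v i = of_int w * (2 * (r + of_int (b n) * v n))"
      using t(2) by (simp add: r_def mult.assoc)
    also have "\<dots> = 2 * (of_int w * r + of_int (b n) * (of_int w * v n))"
      by (simp add: algebra_simps)
    also have "\<dots> = 2 * (of_int w * r + of_int (2 * b n) * s)"
      by (simp add: w(2) algebra_simps)
    finally have "of_int (w * t) * v i = 2 * (of_int w * r + of_int (2 * b n) * s)" .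
    moreover have "r \<in> int_span v n"
      by (auto simp: r_def int_span_def)
    ultimately show "\<exists>u. odd u \<and> (\<exists>x\<in>int_span v n. of_int u * v i = 2 * x)"
      using w(1) t(1) s
      by (intro exI[of _ "w * t"] conjI bexI[of _ "of_int w * r + of_int (2 * b n) * s"]
          int_span_add int_span_of_int_mult) auto
  qed
  then have "s = 0"
    by (simp add: s_def)
  moreover have "(of_int w :: 'a) \<noteq> 0"
    using w(1) by auto
  ultimately have "v n = 0"
    using w(2) by simp
  with zero Suc.prems(1) show ?case
    by (auto simp: less_Suc_eq)
qed simp

section \<open>The ring generated by a root of unity\<close>

locale root_of_unity_span =
  fixes \<omega> :: complex and N :: nat
  assumes N: "N > 0" and root: "\<omega> ^ N = 1"
begin

text \<open>The ring \<open>\<int>[\<omega>]\<close> as a finitely generated additive group: since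
  \<open>\<omega> ^ N = 1\<close>, the first \<open>N\<close> powers suffice.\<close>

definition R :: "complex set" where "R = int_span (\<lambda>i. \<omega> ^ i) N"

lemma power_in_R: "\<omega> ^ k \<in> R"
proof -
  have "\<omega> ^ k = \<omega> ^ (N * (k div N) + k mod N)"
    by simp
  also have "\<dots> = \<omega> ^ (k mod N)"
    unfolding power_add power_mult by (simp add: root)
  also have "\<dots> \<in> R"
    unfolding R_def using N int_span_gen[of "k mod N" N "\<lambda>i. \<omega> ^ i"] by simp
  finally show ?thesis .
qed

lemma R_add: "x \<in> R \<Longrightarrow> y \<in> R \<Longrightarrow> x + y \<in> R"
  unfolding R_def by (rule int_span_add)

lemma R_of_int: "of_int m \<in> R"
  using int_span_of_int_mult[of "\<omega> ^ 0" "\<lambda>i. \<omega> ^ i" N m] power_in_R[of 0] by (simp add: R_def)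

lemma R_mult:
  assumes "x \<in> R" "y \<in> R" shows "x * y \<in> R"
proof -
  obtain a b where ab: "x = (\<Sum>i<N. of_int (a i) * \<omega> ^ i)" "y = (\<Sum>j<N. of_int (b j) * \<omega> ^ j)"
    using assms by (auto simp: R_def int_span_def)
  have "x * y = (\<Sum>i<N. \<Sum>j<N. of_int (a i * b j) * \<omega> ^ (i + j))"
    unfolding ab sum_product by (simp add: power_add mult_ac)
  also have "\<dots> \<in> R"
    unfolding R_def
    by (intro int_span_sum int_span_of_int_mult power_in_R[unfolded R_def])
  finally show ?thesis .
qed

lemma R_diff: "x \<in> R \<Longrightarrow> y \<in> R \<Longrightarrow> x - y \<in> R"
  using R_add[of x "of_int (-1) * y"] R_mult[OF R_of_int[of "-1"]] by simp

text \<open>Otherwise each power of \<open>\<omega>\<close> would be twice a ring element, and the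
  elimination lemma with \<open>u = 1\<close> would make all of them zero, including
  \<open>\<omega> ^ 0\<close>.\<close>

lemma half_notin_R: "1 / 2 \<notin> R"
proof
  assume half: "1 / 2 \<in> R"
  have "\<omega> ^ 0 = 0"
  proof (rule generators_zero_if_two_divisible[where v = "\<lambda>i. \<omega> ^ i" and n = N])
    fix i
    have "1 / 2 * \<omega> ^ i \<in> R"
      by (intro R_mult half power_in_R)
    then show "\<exists>u. odd u \<and> (\<exists>x\<in>int_span (\<lambda>i. \<omega> ^ i) N. of_int u * \<omega> ^ i = 2 * x)"
      by (intro exI[of _ 1] conjI bexI[of _ "1 / 2 * \<omega> ^ i"]) (auto simp: R_def)
  qed (rule N)
  then show False
    by simp
qed

text \<open>The recursion is the double angle formula, so \<open>c n\<close> stands for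
  \<open>cos (2 ^ n * \<phi>)\<close>. A repeated value other than 1 would make 2 invertible in
  \<open>R\<close>.\<close>

lemma R_doubling_orbit:
  assumes c0: "c 0 \<in> R" and rec: "\<And>n. c (Suc n) = 2 * (c n)\<^sup>2 - 1"
    and period: "i < j" "c i = c j"
  shows "c 0 \<in> {0, 1, -1}"
proof -
  have two: "2 \<in> R" and one: "1 \<in> R"
    using R_of_int[of 2] R_of_int[of 1] by auto
  have cR: "c n \<in> R" for n
    by (induction n) (auto simp: c0 rec power2_eq_square intro!: R_diff R_mult two one)
  \<comment> \<open>Each doubling multiplies \<open>c n - 1\<close> by \<open>2 * (c n + 1)\<close>,
    so a factor 2 can be split off after \<open>k + 1\<close> doublings.\<close>
  have "\<exists>r\<in>R. c (Suc (n + k)) - 1 = 2 * (c n - 1) * r" for n k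
  proof (induction k)
    case 0
    show ?case
      by (rule bexI[of _ "c n + 1"])
        (auto simp: rec power2_eq_square algebra_simps intro!: R_add cR one)
  next
    case (Suc k)
    then obtain r where r: "r \<in> R" "c (Suc (n + k)) - 1 = 2 * (c n - 1) * r"
      by blast
    have "c (Suc (n + Suc k)) - 1 = 2 * (c (Suc (n + k)) - 1) * (c (Suc (n + k)) + 1)"
      unfolding add_Suc_right rec[of "Suc (n + k)"] by (simp add: power2_eq_square algebra_simps)
    also have "\<dots> = 2 * (c n - 1) * (2 * r * (c (Suc (n + k)) + 1))"
      by (simp add: r(2))
    finally show ?case
      by (rule bexI) (intro R_mult R_add two cR one r(1))
  qed
  \<comment> \<open>The choice \<open>j - Suc i\<close> turns \<open>Suc (i + k)\<close> into
    \<open>j\<close>, and \<open>c j = c i\<close> closes the cycle.\<close>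
  from this[of i "j - Suc i"] period obtain r where r: "r \<in> R" "c i - 1 = 2 * (c i - 1) * r"
    by auto
  have "1 - 2 * r \<noteq> 0"
    using r(1) half_notin_R by (metis eq_iff_diff_eq_0 nonzero_mult_div_cancel_left zero_neq_numeral)
  moreover have "(c i - 1) * (1 - 2 * r) = 0"
    using r(2) by (simp add: algebra_simps)
  ultimately have "c i = 1"
    by simp
  \<comment> \<open>Predecessors of 1 and -1 have square 1 and 0; a predecessor of 0 would have
    square 1/2, which lies outside \<open>R\<close>.\<close>
  have pred: "c n \<in> {0, 1, -1}" if "c (Suc n) \<in> {0, 1, -1}" for n
  proof -
    have "(c n)\<^sup>2 \<noteq> 1 / 2"
      using half_notin_R R_mult[OF cR[of n] cR[of n]] by (metis power2_eq_square)
    with that have "(c n)\<^sup>2 = 0 \<or> (c n)\<^sup>2 = 1"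
      by (auto simp: rec field_simps)
    then show ?thesis
      by (auto simp: power2_eq_1_iff)
  qed
  have "c n \<in> {0, 1, -1} \<Longrightarrow> c 0 \<in> {0, 1, -1}" for n
    by (induction n) (use pred in blast)+
  with \<open>c i = 1\<close> show ?thesis
    by blast
qed

end

text \<open>The two rationality assumptions act differently: that on \<open>\<theta>\<close> places
  \<open>cos \<phi>\<close> in the ring generated by \<open>cis \<theta>\<close>, that on
  \<open>\<phi>\<close> makes its orbit under angle doubling finite.\<close>

lemma cos_eq_two_cos_minus_one:
  fixes \<phi> \<theta> :: real
  assumes rat: "\<phi> / pi \<in> \<rat>" "\<theta> / pi \<in> \<rat>" and rel: "cos \<phi> = 2 * cos \<theta> - 1"
  shows "\<exists>n::int. \<phi> = of_int n * pi / 2"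
proof -
  obtain a :: int and b :: nat where ab: "b > 0" "\<phi> / pi = a / b"
    using rat(1) by (auto simp: Rats_eq_int_div_nat)
  obtain p :: int and q :: nat where pq: "q > 0" "\<theta> / pi = p / q"
    using rat(2) by (auto simp: Rats_eq_int_div_nat)
  have phi: "\<phi> = pi * a / b" and theta: "\<theta> = pi * p / q"
    using ab pq by (auto simp: field_simps)
  \<comment> \<open>The exponent is \<open>2 * n\<close> because the \<open>n\<close>-th power is
    only known to be 1 or -1.\<close>
  have cis_root: "cis (pi * of_int m / real n) ^ (2 * n) = 1" if "n > 0" for m :: int and n :: nat
  proof -
    have "cis (pi * of_int m / real n) ^ (2 * n) = cis (2 * pi * of_int m)"
      unfolding Complex.DeMoivre using that by (simp add: field_simps)
    then show ?thesis
      by simp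
  qed
  interpret root_of_unity_span "cis \<theta>" "2 * q"
    using pq(1) cis_root[of q p] by unfold_locales (auto simp: theta)
  define c where "c n = complex_of_real (cos (2 ^ n * \<phi>))" for n
  \<comment> \<open>The inverse of \<open>cis \<theta>\<close> is one of its powers, so
    \<open>2 * cos \<theta>\<close> is a sum of two powers.\<close>
  have "cis \<theta> ^ (2 * q - 1) * cis \<theta> = 1"
    using root N by (metis Suc_pred' power_Suc2)
  then have inv: "cis \<theta> ^ (2 * q - 1) = cis (- \<theta>)"
    by (metis cis_inverse inverse_unique mult.commute)
  have "c 0 = cis \<theta> ^ 1 + cis \<theta> ^ (2 * q - 1) - of_int 1"
    unfolding inv by (simp add: c_def rel complex_eq_iff)
  then have c0: "c 0 \<in> R"
    by (metis R_add R_diff R_of_int power_in_R)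
  have rec: "c (Suc n) = 2 * (c n)\<^sup>2 - 1" for n
    using cos_double_cos[of "2 ^ n * \<phi>"] by (simp add: c_def mult.assoc)
  \<comment> \<open>Pigeonhole: each \<open>c n\<close> is the real part of a root of unity of the
    fixed order \<open>2 * b\<close>.\<close>
  have "c n \<in> (\<lambda>z. complex_of_real (Re z)) ` {z. z ^ (2 * b) = 1}" for n
  proof
    have "(cis \<phi> ^ 2 ^ n) ^ (2 * b) = (cis \<phi> ^ (2 * b)) ^ 2 ^ n"
      by (simp only: power_mult[symmetric] mult.commute)
    then show "cis \<phi> ^ 2 ^ n \<in> {z. z ^ (2 * b) = 1}"
      using cis_root[OF ab(1), of a] by (simp add: phi)
  qed (simp add: c_def Complex.DeMoivre)
  moreover have "finite {z::complex. z ^ (2 * b) = 1}"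
    using ab(1) by (intro finite_roots_unity) auto
  ultimately have "\<not> inj c"
    by (meson finite_imageI finite_subset image_subsetI infinite_UNIV_nat finite_imageD)
  then obtain i j where "i < j" "c i = c j"
    unfolding inj_def by (metis linorder_neqE_nat)
  from R_doubling_orbit[OF c0 rec this] have "cos \<phi> = 0 \<or> \<bar>cos \<phi>\<bar> = 1"
    by (auto simp: c_def complex_eq_iff)
  then consider "cos \<phi> = 0" | "sin \<phi> = 0"
    using sin_cos_squared_add[of \<phi>] by (metis abs_square_eq_1 add_cancel_left_left zero_eq_power2)
  then show ?thesis
  proof cases
    case 1
    then show ?thesis by (auto simp: cos_zero_iff_int)
  next
    case 2
    then obtain m :: int where "\<phi> = of_int (2 * m) * pi / 2"
      by (auto simp: sin_zero_iff_int2)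
    then show ?thesis by blast
  qed
qed

section \<open>Words and homomorphisms\<close>

text \<open>An induction principle for \<open>words\<close>: powers are split into single factors
  once and for all. Taking \<open>T\<close> to be \<open>UNIV\<close> gives containment in the
  carrier.\<close>

lemma words_subset:
  assumes "monoid G" and S: "S \<subseteq> carrier G" and one: "\<one>\<^bsub>G\<^esub> \<in> T"
    and step: "\<And>g x. g \<in> S \<Longrightarrow> x \<in> T \<inter> carrier G \<Longrightarrow> g \<otimes>\<^bsub>G\<^esub> x \<in> T"
  shows "words G S \<subseteq> T \<inter> carrier G"
proof -
  interpret monoid G by fact
  have pow: "g [^]\<^bsub>G\<^esub> (k::nat) \<otimes>\<^bsub>G\<^esub> x \<in> T \<inter> carrier G" if "g \<in> S" "x \<in> T \<inter> carrier G" for g k x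
  proof (induction k)
    case (Suc k)
    have "g \<in> carrier G" using S that by blast
    moreover have "g [^]\<^bsub>G\<^esub> Suc k \<otimes>\<^bsub>G\<^esub> x = g \<otimes>\<^bsub>G\<^esub> (g [^]\<^bsub>G\<^esub> k \<otimes>\<^bsub>G\<^esub> x)"
      unfolding nat_pow_Suc2[OF \<open>g \<in> carrier G\<close>] using that calculation by (intro m_assoc) auto
    ultimately show ?case
      using Suc.IH step[OF that(1) Suc.IH] by simp
  qed (use that in simp)
  have "foldr (\<lambda>(g, k) h. (g [^]\<^bsub>G\<^esub> k) \<otimes>\<^bsub>G\<^esub> h) w \<one>\<^bsub>G\<^esub> \<in> T \<inter> carrier G"
    if "\<forall>(g, k) \<in> set w. g \<in> S" for w :: "('a \<times> nat) list"
    using that by (induction w) (use one pow in auto)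
  then show ?thesis
    by (auto simp: words_def)
qed

lemma one_in_words: "\<one>\<^bsub>G\<^esub> \<in> words G S"
  by (auto simp: words_def intro!: exI[of _ "[]"])

lemma mult_in_words:
  assumes "monoid G" "g \<in> S" "g \<in> carrier G" "x \<in> words G S"
  shows "g \<otimes>\<^bsub>G\<^esub> x \<in> words G S"
proof -
  interpret monoid G by fact
  obtain w :: "('a \<times> nat) list" where "\<forall>(g, k) \<in> set w. g \<in> S"
    and "x = foldr (\<lambda>(g, k) h. (g [^]\<^bsub>G\<^esub> k) \<otimes>\<^bsub>G\<^esub> h) w \<one>\<^bsub>G\<^esub>"
    using assms(4) by (auto simp: words_def)
  with assms(2,3) show ?thesis
    unfolding words_def by (intro CollectI exI[of _ "(g, 1) # w"]) auto
qed

text \<open>Moves questions about \<open>SO3\<close> and \<open>SU2\<close> to quaternions. Each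
  inclusion is an induction over words, in \<open>H\<close> and in \<open>G\<close> respectively.
  Since \<open>hom\<close> only speaks of products, the unit is treated separately.\<close>

lemma words_hom_image:
  assumes "monoid G" "monoid H" and h: "h \<in> hom G H" "h \<one>\<^bsub>G\<^esub> = \<one>\<^bsub>H\<^esub>" and S: "S \<subseteq> carrier G"
  shows "words H (h ` S) = h ` words G S"
proof
  have hS: "h ` S \<subseteq> carrier H"
    using h(1) S by (auto simp: hom_def)
  have WG: "words G S \<subseteq> carrier G"
    using words_subset[OF assms(1) S, of UNIV] by simp
  show "words H (h ` S) \<subseteq> h ` words G S"
  proof (rule order_trans[OF words_subset[OF assms(2) hS] Int_lower1])
    show "\<one>\<^bsub>H\<^esub> \<in> h ` words G S"
      using h(2) one_in_words by (metis imageI)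
    fix g x assume "g \<in> h ` S" "x \<in> h ` words G S \<inter> carrier H"
    then obtain a y where "a \<in> S" "y \<in> words G S" "g = h a" "x = h y"
      by blast
    then show "g \<otimes>\<^bsub>H\<^esub> x \<in> h ` words G S"
      using mult_in_words[OF assms(1), of a S y] hom_mult[OF h(1), of a y] S WG
      by (metis imageI subsetD)
  qed
  have "words G S \<subseteq> {x. h x \<in> words H (h ` S)} \<inter> carrier G"
  proof (rule words_subset[OF assms(1) S])
    show "\<one>\<^bsub>G\<^esub> \<in> {x. h x \<in> words H (h ` S)}"
      using h(2) one_in_words by (metis mem_Collect_eq)
    fix g x assume "g \<in> S" "x \<in> {x. h x \<in> words H (h ` S)} \<inter> carrier G"
    then show "g \<otimes>\<^bsub>G\<^esub> x \<in> {x. h x \<in> words H (h ` S)}"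
      using mult_in_words[OF assms(2), of "h g" "h ` S" "h x"] hom_mult[OF h(1), of g x] S hS
      by (auto simp: subset_iff)
  qed
  then show "h ` words G S \<subseteq> words H (h ` S)"
    by blast
qed

section \<open>Unit quaternions\<close>

text \<open>The unit quaternions as pairs of scalar and vector part: the product is free of
  coordinates, and the vector part points along the axis of rotation.\<close>

definition quat :: "(real \<times> (real^3)) monoid" where
  "quat = \<lparr>carrier = {(w, u). w\<^sup>2 + u \<bullet> u = 1},
    mult = (\<lambda>(w, u) (x, v). (w * x - u \<bullet> v, w *\<^sub>R v + x *\<^sub>R u + cross3 u v)), one = (1, 0)\<rparr>"

lemma quat_simps [simp]:
  "(w, u) \<in> carrier quat \<longleftrightarrow> w\<^sup>2 + u \<bullet> u = 1"
  "(w, u) \<otimes>\<^bsub>quat\<^esub> (x, v) = (w * x - u \<bullet> v, w *\<^sub>R v + x *\<^sub>R u + cross3 u v)"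
  "\<one>\<^bsub>quat\<^esub> = (1, 0)"
  by (simp_all add: quat_def)

lemma monoid_quat: "monoid quat"
proof (rule monoidI)
  fix p q assume *: "p \<in> carrier quat" "q \<in> carrier quat"
  obtain w u x v where pq: "p = (w, u)" "q = (x, v)"
    by (cases p, cases q)
  \<comment> \<open>Multiplicativity of the quaternion norm, that is, Euler's four-square
    identity.\<close>
  have "(w * x - u \<bullet> v)\<^sup>2 + (w *\<^sub>R v + x *\<^sub>R u + cross3 u v) \<bullet> (w *\<^sub>R v + x *\<^sub>R u + cross3 u v)
      = (w\<^sup>2 + u \<bullet> u) * (x\<^sup>2 + v \<bullet> v)"
    by (simp add: cross3_simps forall_3 power2_eq_square)
  then show "p \<otimes>\<^bsub>quat\<^esub> q \<in> carrier quat"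
    using * by (simp add: pq)
next
  fix p q r :: "real \<times> (real^3)"
  obtain w u x v y z where pq: "p = (w, u)" "q = (x, v)" "r = (y, z)"
    by (cases p, cases q, cases r)
  show "p \<otimes>\<^bsub>quat\<^esub> q \<otimes>\<^bsub>quat\<^esub> r = p \<otimes>\<^bsub>quat\<^esub> (q \<otimes>\<^bsub>quat\<^esub> r)"
    by (simp add: pq cross3_simps forall_3)
qed (auto simp: split: prod.splits)

definition quat_polar :: "real \<Rightarrow> real^3 \<Rightarrow> real \<times> (real^3)" where
  "quat_polar \<theta> k = (cos \<theta>, sin \<theta> *\<^sub>R k)"

lemma quat_polar_carrier: "norm k = 1 \<Longrightarrow> quat_polar \<theta> k \<in> carrier quat"
  by (simp add: quat_polar_def dot_square_norm power2_eq_square[symmetric])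

lemma quat_polar_mult:
  "norm k = 1 \<Longrightarrow> quat_polar \<alpha> k \<otimes>\<^bsub>quat\<^esub> quat_polar \<beta> k = quat_polar (\<alpha> + \<beta>) k"
  by (simp add: quat_polar_def dot_square_norm cross_mult_left cross_mult_right cos_add sin_add
      scaleR_add_left mult.commute)

lemma quat_polar_pow:
  assumes "norm k = 1"
  shows "quat_polar \<theta> k [^]\<^bsub>quat\<^esub> n = quat_polar (of_nat n * \<theta>) k"
proof (induction n)
  case (Suc n)
  then show ?case
    using quat_polar_mult[OF assms, of "real n * \<theta>" \<theta>] by (simp add: nat_pow_def algebra_simps)
qed (simp add: quat_polar_def nat_pow_def)

lemma quat_polar_ex:
  assumes "q \<in> carrier quat"
  shows "\<exists>\<theta> k. norm k = 1 \<and> q = quat_polar \<theta> k"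
proof -
  obtain w u where q: "q = (w, u)" by (cases q)
  then have "w\<^sup>2 + (norm u)\<^sup>2 = 1"
    using assms by (simp add: dot_square_norm)
  then obtain \<theta> where \<theta>: "w = cos \<theta>" "norm u = sin \<theta>"
    using sincos_total_2pi by metis
  show ?thesis
  proof (cases "u = 0")
    \<comment> \<open>Here \<open>sin \<theta> = 0\<close>, so any unit vector can serve as
      axis.\<close>
    case True
    then show ?thesis
      using \<theta> by (intro exI[of _ \<theta>] exI[of _ "axis 1 1"]) (simp add: q quat_polar_def)
  next
    case False
    then show ?thesis
      using \<theta>[symmetric]
      by (intro exI[of _ \<theta>] exI[of _ "u /\<^sub>R norm u"]) (simp add: q quat_polar_def)
  qed
qed

text \<open>The map sending \<open>v\<close> to \<open>q v q'\<close>, where \<open>q'\<close> is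
  the conjugate \<open>(w, - u)\<close>, written out by dot and cross products. With the conjugate
  in place of the inverse, multiplicativity is a polynomial identity free of norm
  conditions.\<close>

definition quat_SO3 :: "real \<times> (real^3) \<Rightarrow> real^3^3" where
  "quat_SO3 = (\<lambda>(w, u). matrix (\<lambda>v. (w\<^sup>2 - u \<bullet> u) *\<^sub>R v + (2 * w) *\<^sub>R cross3 u v + (2 * (u \<bullet> v)) *\<^sub>R u))"

lemma quat_SO3_mult_vec:
  "quat_SO3 (w, u) *v v = (w\<^sup>2 - u \<bullet> u) *\<^sub>R v + (2 * w) *\<^sub>R cross3 u v + (2 * (u \<bullet> v)) *\<^sub>R u"
proof -
  have "linear (\<lambda>v. (w\<^sup>2 - u \<bullet> u) *\<^sub>R v + (2 * w) *\<^sub>R cross3 u v + (2 * (u \<bullet> v)) *\<^sub>R u)"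
    by (rule linearI) (simp_all add: cross_add_right cross_mult_right inner_right_distrib algebra_simps)
  then show ?thesis
    by (simp add: quat_SO3_def matrix_works linear_matrix_vector_mul_eq)
qed

lemma quat_SO3_mult: "quat_SO3 (p \<otimes>\<^bsub>quat\<^esub> q) = quat_SO3 p ** quat_SO3 q"
proof -
  obtain w u x v where pq: "p = (w, u)" "q = (x, v)"
    by (cases p, cases q)
  have "quat_SO3 (p \<otimes>\<^bsub>quat\<^esub> q) *v z = quat_SO3 p *v (quat_SO3 q *v z)" for z
    unfolding pq quat_simps quat_SO3_mult_vec
    by (simp add: cross3_simps forall_3 power2_eq_square)
  then show ?thesis
    by (simp add: matrix_eq matrix_vector_mul_assoc)
qed

lemma quat_SO3_one: "quat_SO3 (1, 0) = mat 1"
  by (simp add: matrix_eq quat_SO3_mult_vec)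

text \<open>The angle doubles because the quaternion acts from both sides.\<close>

lemma quat_SO3_polar:
  assumes "norm k = 1"
  shows "quat_SO3 (quat_polar \<theta> k) = rotation (2 * \<theta>) k"
proof -
  have "(cos \<theta>)\<^sup>2 - (sin \<theta> *\<^sub>R k) \<bullet> (sin \<theta> *\<^sub>R k) = cos (2 * \<theta>)"
    using assms by (simp add: dot_square_norm cos_double power2_eq_square)
  then have "quat_SO3 (quat_polar \<theta> k) *v v =
      cos (2 * \<theta>) *\<^sub>R v + (2 * sin \<theta> * cos \<theta>) *\<^sub>R cross3 k v + (2 * (sin \<theta>)\<^sup>2 * (k \<bullet> v)) *\<^sub>R k" for v
    unfolding quat_polar_def quat_SO3_mult_vec by (simp add: cross_mult_left power2_eq_square mult_ac)
  moreover have "2 * (sin \<theta>)\<^sup>2 = 1 - cos (2 * \<theta>)"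
    by (simp add: cos_double_sin)
  ultimately show ?thesis
    by (simp only: matrix_eq rotation_mult_vec sin_double) simp
qed

lemma quat_SO3_hom: "quat_SO3 \<in> hom quat SO3"
proof (rule homI)
  fix q assume q: "q \<in> carrier quat"
  obtain w u where wu: "q = (w, u)" by (cases q)
  have norm: "w\<^sup>2 + u \<bullet> u = 1"
    using q by (simp add: wu)
  have entries: "quat_SO3 (x, v) $ i $ j = (quat_SO3 (x, v) *v axis j 1) $ i" for x v i j
    by (simp add: matrix_vector_mul_component inner_axis)
  \<comment> \<open>Transposition corresponds to quaternion conjugation, which inverts a unit
    quaternion.\<close>
  have "transpose (quat_SO3 (w, u)) = quat_SO3 (w, - u)"
    by (simp add: vec_eq_iff transpose_def entries quat_SO3_mult_vec forall_3 axis_def cross3_simps)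
  moreover have "(w, - u) \<otimes>\<^bsub>quat\<^esub> (w, u) = (1, 0)"
    using norm by (simp add: power2_eq_square)
  ultimately have "transpose (quat_SO3 (w, u)) ** quat_SO3 (w, u) = mat 1"
    by (simp add: quat_SO3_mult[symmetric] quat_SO3_one del: quat_simps)
  \<comment> \<open>The homogeneous form of determinant 1, a polynomial identity in \<open>w\<close>
    and \<open>u\<close>.\<close>
  moreover have "det (quat_SO3 (w, u)) = (w\<^sup>2 + u \<bullet> u) ^ 3"
    unfolding det_3 entries quat_SO3_mult_vec
    by (simp add: axis_def cross3_def inner_vec_def sum_3) algebra
  ultimately show "quat_SO3 q \<in> carrier SO3"
    using norm by (simp add: wu SO3_def rotation_matrix_def orthogonal_matrix)
qed (simp add: quat_SO3_mult SO3_def)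

text \<open>\<open>matX\<close>, \<open>matY\<close>, \<open>matZ\<close> multiply like i, j, k, so
  this is the usual matrix representation of the quaternions.\<close>

definition quat_SU2 :: "real \<times> (real^3) \<Rightarrow> complex^2^2" where
  "quat_SU2 = (\<lambda>(w, u). w *\<^sub>R mat 1 + (u $ 1 *\<^sub>R matX + u $ 2 *\<^sub>R matY + u $ 3 *\<^sub>R matZ))"

lemma quat_SU2_entries:
  "quat_SU2 (w, u) $ 1 $ 1 = Complex w (u $ 3)" "quat_SU2 (w, u) $ 1 $ 2 = Complex (u $ 1) (u $ 2)"
  "quat_SU2 (w, u) $ 2 $ 1 = Complex (- u $ 1) (u $ 2)" "quat_SU2 (w, u) $ 2 $ 2 = Complex w (- u $ 3)"
  by (simp_all add: quat_SU2_def matX_def matY_def matZ_def mat_def complex_eq_iff)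

lemma quat_SU2_polar: "quat_SU2 (quat_polar \<theta> k) = su2_rotation \<theta> k"
  by (simp add: quat_SU2_def quat_polar_def su2_rotation_def scaleR_add_right)

lemma quat_SU2_hom: "quat_SU2 \<in> hom quat SU2"
proof (rule homI)
  fix q assume q: "q \<in> carrier quat"
  obtain w u where wu: "q = (w, u)" by (cases q)
  have "w * w + (u $ 1 * u $ 1 + u $ 2 * u $ 2 + u $ 3 * u $ 3) = 1"
    using q by (simp add: wu inner_vec_def sum_3 power2_eq_square)
  then show "quat_SU2 q \<in> carrier SU2"
    by (simp add: wu SU2_def conj_transpose_def matrix_matrix_mult_def vec_eq_iff forall_2 sum_2 det_2
        mat_def quat_SU2_entries complex_eq_iff algebra_simps)
next
  fix p q :: "real \<times> (real^3)"
  obtain w u x v where pq: "p = (w, u)" "q = (x, v)"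
    by (cases p, cases q)
  have "quat_SU2 (p \<otimes>\<^bsub>quat\<^esub> q) $ i $ j = (quat_SU2 p ** quat_SU2 q) $ i $ j" for i j
    using exhaust_2[of i] exhaust_2[of j]
    by (auto simp: pq matrix_matrix_mult_def sum_2 quat_SU2_entries complex_eq_iff cross3_def
        inner_vec_def sum_3 algebra_simps)
  then show "quat_SU2 (p \<otimes>\<^bsub>quat\<^esub> q) = quat_SU2 p \<otimes>\<^bsub>SU2\<^esub> quat_SU2 q"
    by (simp only: vec_eq_iff SU2_def monoid.simps) simp
qed

text \<open>The first row shows all four real coordinates. Hence finiteness of sets is not affected
  by this map, whereas \<open>quat_SO3\<close> identifies a quaternion with its negative.\<close>

lemma inj_quat_SU2: "inj quat_SU2"
proof (rule injI)
  fix p q assume eq: "quat_SU2 p = quat_SU2 q"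
  obtain w u x v where pq: "p = (w, u)" "q = (x, v)"
    by (cases p, cases q)
  have "quat_SU2 (w, u) $ i $ j = quat_SU2 (x, v) $ i $ j" for i j
    using eq by (simp add: pq)
  from this[of 1 1] this[of 1 2] show "p = q"
    by (simp add: pq quat_SU2_entries vec_eq_iff forall_3)
qed

section \<open>Infinitely many words from an irrational angle\<close>

lemma cos_multiples_eq_imp_rational:
  fixes x :: real
  assumes "cos (real m * x) = cos (real n * x)" "m \<noteq> n"
  shows "x / pi \<in> \<rat>"
proof -
  \<comment> \<open>A difference of cosines is a product of two sines, so one of them vanishes; its
    multiplier \<open>s\<close> is nonzero since \<open>m\<close> and \<open>n\<close> are distinct
    naturals.\<close>
  have "sin ((real m + real n) * x / 2) * sin ((real n - real m) * x / 2) = 0"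
    using assms(1) cos_diff_cos[of "real m * x" "real n * x"] by (simp add: algebra_simps)
  then obtain s where s: "s \<in> {real m + real n, real n - real m}" "sin (s * x / 2) = 0"
    by auto
  then obtain j :: int where "s * x / 2 = of_int j * pi"
    by (auto simp: sin_zero_iff_int2)
  moreover have "s \<noteq> 0" "s \<in> \<rat>"
    using s(1) assms(2) by auto
  ultimately have "x / pi = 2 * of_int j / s"
    by (simp add: field_simps)
  also have "\<dots> \<in> \<rat>"
    using \<open>s \<in> \<rat>\<close> by simp
  finally show ?thesis .
qed

text \<open>The trace reveals the cosine of the angle, which serves to tell powers of a rotation
  apart.\<close>

lemma trace_rotation: "norm k = 1 \<Longrightarrow> trace (rotation \<phi> k) = 1 + 2 * cos \<phi>"
proof -
  assume "norm k = 1"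
  then have "k $ 1 * k $ 1 + k $ 2 * k $ 2 + k $ 3 * k $ 3 = 1"
    by (simp add: norm_eq_1 inner_vec_def sum_3)
  moreover have "trace (rotation \<phi> k) = (\<Sum>i\<in>UNIV. (rotation \<phi> k *v axis i 1) $ i)"
    by (simp add: trace_def matrix_vector_mul_component inner_axis)
  moreover have "\<dots> = 3 * cos \<phi> + (1 - cos \<phi>) * (k $ 1 * k $ 1 + k $ 2 * k $ 2 + k $ 3 * k $ 3)"
    by (simp add: sum_3 rotation_mult_vec axis_def cross3_def inner_vec_def algebra_simps)
  ultimately show ?thesis
    by simp
qed

text \<open>The powers of the product are words, and their images are pairwise distinct rotations
  about one axis. The claim is made for the image in \<open>SO3\<close>, from which infinitude
  passes back to the quaternions.\<close>

lemma infinite_words_quat: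
  assumes "p \<in> carrier quat" "q \<in> carrier quat" and k: "norm k = 1"
    and pq: "p \<otimes>\<^bsub>quat\<^esub> q = quat_polar \<theta> k" and irr: "2 * \<theta> / pi \<notin> \<rat>"
  shows "infinite (quat_SO3 ` words quat {p, q})"
proof
  interpret monoid quat by (rule monoid_quat)
  assume fin: "finite (quat_SO3 ` words quat {p, q})"
  have "(p \<otimes>\<^bsub>quat\<^esub> q) [^]\<^bsub>quat\<^esub> (n::nat) \<in> words quat {p, q}" for n
  proof (induction n)
    case 0
    show ?case using one_in_words[of quat] by simp
  next
    case (Suc n)
    have "(p \<otimes>\<^bsub>quat\<^esub> q) [^]\<^bsub>quat\<^esub> Suc n = p \<otimes>\<^bsub>quat\<^esub> (q \<otimes>\<^bsub>quat\<^esub> ((p \<otimes>\<^bsub>quat\<^esub> q) [^]\<^bsub>quat\<^esub> n))"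
      using assms(1,2) by (simp only: nat_pow_Suc2 m_closed m_assoc nat_pow_closed)
    also have "\<dots> \<in> words quat {p, q}"
      by (intro mult_in_words[OF monoid_quat] Suc.IH assms(1,2)) auto
    finally show ?case .
  qed
  then have "rotation (2 * (real n * \<theta>)) k \<in> quat_SO3 ` words quat {p, q}" for n
    unfolding pq quat_polar_pow[OF k] by (simp only: quat_SO3_polar[OF k, symmetric] imageI)
  then have "range (\<lambda>n. rotation (2 * (real n * \<theta>)) k) \<subseteq> quat_SO3 ` words quat {p, q}"
    by blast
  then have "\<not> inj (\<lambda>n. rotation (2 * (real n * \<theta>)) k)"
    using fin by (meson finite_subset finite_imageD infinite_UNIV_nat)
  then obtain m n where "m \<noteq> n" and eq: "rotation (2 * (real m * \<theta>)) k = rotation (2 * (real n * \<theta>)) k"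
    unfolding inj_def by blast
  have "cos (real m * (2 * \<theta>)) = cos (real n * (2 * \<theta>))"
    using arg_cong[OF eq, of trace] by (simp add: trace_rotation[OF k] mult.left_commute)
  from cos_multiples_eq_imp_rational[OF this \<open>m \<noteq> n\<close>] irr show False
    by simp
qed

section \<open>The binary octahedral group\<close>

text \<open>For orthonormal \<open>k1\<close> and \<open>k2\<close>, these are coordinates in a
  basis that multiplies like 1, i, j, k.\<close>

definition frame_quat :: "real^3 \<Rightarrow> real^3 \<Rightarrow> real \<Rightarrow> real \<Rightarrow> real \<Rightarrow> real \<Rightarrow> real \<times> (real^3)" where
  "frame_quat k1 k2 a b c d = (a, b *\<^sub>R k1 + c *\<^sub>R k2 + d *\<^sub>R cross3 k1 k2)"

text \<open>The two parts are the 24 Hurwitz units and the 24 quaternions \<open>h / \<surd>2\<close> with \<open>h\<close> integral of norm 2;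
  multiplication by \<open>(1 + k1) / \<surd>2\<close> exchanges them.\<close>

definition octahedral :: "real^3 \<Rightarrow> real^3 \<Rightarrow> (real \<times> (real^3)) set" where
  "octahedral k1 k2 =
     {frame_quat k1 k2 (of_int a / 2) (of_int b / 2) (of_int c / 2) (of_int d / 2) | a b c d.
        a\<^sup>2 + b\<^sup>2 + c\<^sup>2 + d\<^sup>2 = 4 \<and> even (a + b) \<and> even (b + c) \<and> even (c + d)} \<union>
     {frame_quat k1 k2 (of_int a / sqrt 2) (of_int b / sqrt 2) (of_int c / sqrt 2) (of_int d / sqrt 2) | a b c d.
        a\<^sup>2 + b\<^sup>2 + c\<^sup>2 + d\<^sup>2 = 2}"

lemma octahedral_cases:
  assumes "q \<in> octahedral k1 k2"
  obtains a b c d :: int where "a\<^sup>2 + b\<^sup>2 + c\<^sup>2 + d\<^sup>2 = 4" "even (a + b)" "even (b + c)" "even (c + d)"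
      "q = frame_quat k1 k2 (of_int a / 2) (of_int b / 2) (of_int c / 2) (of_int d / 2)"
  | a b c d :: int where "a\<^sup>2 + b\<^sup>2 + c\<^sup>2 + d\<^sup>2 = 2"
      "q = frame_quat k1 k2 (of_int a / sqrt 2) (of_int b / sqrt 2) (of_int c / sqrt 2) (of_int d / sqrt 2)"
  using assms by (auto simp: octahedral_def)

lemma octahedralI1:
  fixes a b c d :: int
  assumes "a\<^sup>2 + b\<^sup>2 + c\<^sup>2 + d\<^sup>2 = 4" "even (a + b)" "even (b + c)" "even (c + d)"
  shows "frame_quat k1 k2 (of_int a / 2) (of_int b / 2) (of_int c / 2) (of_int d / 2) \<in> octahedral k1 k2"
  using assms unfolding octahedral_def by blast

lemma octahedralI2:
  fixes a b c d :: int
  assumes "a\<^sup>2 + b\<^sup>2 + c\<^sup>2 + d\<^sup>2 = 2"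
  shows "frame_quat k1 k2 (of_int a / sqrt 2) (of_int b / sqrt 2) (of_int c / sqrt 2) (of_int d / sqrt 2)
    \<in> octahedral k1 k2"
  using assms unfolding octahedral_def by blast

lemma finite_octahedral: "finite (octahedral k1 k2)"
proof -
  define I where "I = {-2..2::int}"
  have bound: "x \<in> I" if "x\<^sup>2 \<le> 4" for x :: int
    using that power2_le_iff_abs_le[of 2 x] by (auto simp: I_def)
  define F where "F r = (\<lambda>(a, b, c, d). frame_quat k1 k2 (of_int a / r) (of_int b / r) (of_int c / r) (of_int d / r))
    ` (I \<times> I \<times> I \<times> I)" for r
  have "octahedral k1 k2 \<subseteq> F 2 \<union> F (sqrt 2)"
  proof
    fix q assume "q \<in> octahedral k1 k2"
    then show "q \<in> F 2 \<union> F (sqrt 2)"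
    proof (cases rule: octahedral_cases)
      case (1 a b c d)
      have "a\<^sup>2 \<le> 4" "b\<^sup>2 \<le> 4" "c\<^sup>2 \<le> 4" "d\<^sup>2 \<le> 4"
        using 1(1) zero_le_power2[of a] zero_le_power2[of b] zero_le_power2[of c] zero_le_power2[of d]
        by linarith+
      then have "a \<in> I" "b \<in> I" "c \<in> I" "d \<in> I"
        by (simp_all add: bound)
      then show ?thesis
        unfolding F_def by (intro UnI1 image_eqI[of _ _ "(a, b, c, d)"]) (auto simp: 1)
    next
      case (2 a b c d)
      have "a\<^sup>2 \<le> 4" "b\<^sup>2 \<le> 4" "c\<^sup>2 \<le> 4" "d\<^sup>2 \<le> 4"
        using 2(1) zero_le_power2[of a] zero_le_power2[of b] zero_le_power2[of c] zero_le_power2[of d]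
        by linarith+
      then have "a \<in> I" "b \<in> I" "c \<in> I" "d \<in> I"
        by (simp_all add: bound)
      then show ?thesis
        unfolding F_def by (intro UnI2 image_eqI[of _ _ "(a, b, c, d)"]) (auto simp: 2)
    qed
  qed
  then show ?thesis
    by (rule finite_subset) (simp add: F_def I_def)
qed

lemma frame_quat_swap: "frame_quat k1 k2 a b c d = frame_quat k2 k1 a c b (- d)"
  by (simp add: frame_quat_def cross_skew[of k2 k1])

text \<open>The norm and parity conditions survive permutations and sign changes of the coordinates.
  This lets closure under the generator about \<open>k1\<close> yield that for
  \<open>k2\<close>.\<close>

lemma octahedral_swap_subset: "octahedral k1 k2 \<subseteq> octahedral k2 k1"
proof
  fix q assume "q \<in> octahedral k1 k2"
  then show "q \<in> octahedral k2 k1"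
  proof (cases rule: octahedral_cases)
    case (1 a b c d)
    then show ?thesis
      using octahedralI1[of a c b "- d" k2 k1] by (simp add: frame_quat_swap[of k1 k2])
  next
    case (2 a b c d)
    then show ?thesis
      using octahedralI2[of a c b "- d" k2 k1] by (simp add: frame_quat_swap[of k1 k2] algebra_simps)
  qed
qed

lemma octahedral_swap: "octahedral k1 k2 = octahedral k2 k1"
  using octahedral_swap_subset by blast

context
  fixes k1 k2 :: "real^3"
  assumes k: "norm k1 = 1" "norm k2 = 1" "orthogonal k1 k2"
begin

text \<open>The factor is \<open>(1 + k1) / sqrt 2\<close>; it turns the plane of 1 and
  \<open>k1\<close> and the plane of \<open>k2\<close> and \<open>cross3 k1 k2\<close> by 45 degrees
  each.\<close>

lemma polar_mult_frame_quat:
  "quat_polar (pi / 4) k1 \<otimes>\<^bsub>quat\<^esub> frame_quat k1 k2 a b c d =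
     frame_quat k1 k2 ((a - b) / sqrt 2) ((a + b) / sqrt 2) ((c - d) / sqrt 2) ((c + d) / sqrt 2)"
proof -
  have dot: "k1 \<bullet> k1 = 1" "k1 \<bullet> k2 = 0"
    using k by (auto simp: dot_square_norm orthogonal_def)
  have "cross3 k1 (cross3 k1 k2) = - k2"
    using dot by (simp add: Lagrange)
  moreover define r where "r = sqrt 2 / 2"
  have "x / sqrt 2 = r * x" for x
    by (simp add: r_def real_div_sqrt field_simps flip: mult.assoc)
  moreover have "quat_polar (pi / 4) k1 = (r, r *\<^sub>R k1)"
    by (simp add: r_def quat_polar_def cos_45 sin_45)
  ultimately show ?thesis
    using dot by (simp add: frame_quat_def inner_add_right dot_cross_self
        cross_add_right cross_mult_left cross_mult_right algebra_simps)
qed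

lemma octahedral_polar_45_closed:
  assumes "q \<in> octahedral k1 k2"
  shows "quat_polar (pi / 4) k1 \<otimes>\<^bsub>quat\<^esub> q \<in> octahedral k1 k2"
  using assms
proof (cases rule: octahedral_cases)
  case (1 a b c d)
  \<comment> \<open>All four numerators have the same parity, so sums and differences can be halved;
    this halves the sum of squares from 4 to 2.\<close>
  obtain m n r s where ms: "a - b = 2 * m" "a + b = 2 * n" "c - d = 2 * r" "c + d = 2 * s"
    using 1 by (meson even_add even_diff evenE)
  then have eqs: "a = m + n" "b = n - m" "c = r + s" "d = s - r"
    by linarith+
  have "m\<^sup>2 + n\<^sup>2 + r\<^sup>2 + s\<^sup>2 = 2"
    using 1(1) by (simp add: eqs power2_eq_square algebra_simps)
  from octahedralI2[OF this, of k1 k2] show ?thesis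
    by (simp add: 1(5) polar_mult_frame_quat eqs field_simps)
next
  case (2 a b c d)
  \<comment> \<open>An integer and its square have the same parity, so the new numerators
    \<open>a - b\<close>, \<open>a + b\<close>, \<open>c - d\<close>, \<open>c + d\<close> are all
    even or all odd.\<close>
  have "even (a\<^sup>2 + b\<^sup>2 + c\<^sup>2 + d\<^sup>2)"
    using 2(1) by simp
  then have par: "even (a + b + c + d)"
    by simp
  have "frame_quat k1 k2 (of_int (a - b) / 2) (of_int (a + b) / 2) (of_int (c - d) / 2) (of_int (c + d) / 2)
      \<in> octahedral k1 k2"
  proof (rule octahedralI1)
    show "(a - b)\<^sup>2 + (a + b)\<^sup>2 + (c - d)\<^sup>2 + (c + d)\<^sup>2 = 4"
      using 2(1) by (simp add: power2_eq_square algebra_simps)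
  qed (use par in auto)
  then show ?thesis
    by (simp add: 2(2) polar_mult_frame_quat field_simps)
qed

lemma octahedral_polar_closed:
  assumes "q \<in> octahedral k1 k2" "q \<in> carrier quat"
  shows "quat_polar (of_int n * pi / 4) k1 \<otimes>\<^bsub>quat\<^esub> q \<in> octahedral k1 k2"
proof -
  interpret monoid quat by (rule monoid_quat)
  \<comment> \<open>The quaternion with angle \<open>pi / 4\<close> has eighth power 1, so a
    possibly negative \<open>n\<close> can be replaced by its residue modulo 8.\<close>
  define m where "m = nat (n mod 8)"
  have "real_of_int n * pi / 4 = real m * (pi / 4) + 2 * pi * of_int (n div 8)"
  proof -
    have "n = int m + 8 * (n div 8)"
      by (simp add: m_def)
    then have "real_of_int n = real m + 8 * of_int (n div 8)"
      by (metis of_int_add of_int_mult of_int_numeral of_int_of_nat_eq)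
    then show ?thesis
      by (simp add: algebra_simps)
  qed
  then have eq: "quat_polar (of_int n * pi / 4) k1 = quat_polar (pi / 4) k1 [^]\<^bsub>quat\<^esub> m"
    unfolding quat_polar_pow[OF k(1)] by (simp only: quat_polar_def cos_add sin_add) simp
  have e: "quat_polar (pi / 4) k1 \<in> carrier quat"
    using k(1) by (rule quat_polar_carrier)
  have "quat_polar (pi / 4) k1 [^]\<^bsub>quat\<^esub> m \<otimes>\<^bsub>quat\<^esub> q \<in> octahedral k1 k2" for m :: nat
  proof (induction m)
    case (Suc m)
    have "quat_polar (pi / 4) k1 [^]\<^bsub>quat\<^esub> Suc m \<otimes>\<^bsub>quat\<^esub> q
        = quat_polar (pi / 4) k1 \<otimes>\<^bsub>quat\<^esub> (quat_polar (pi / 4) k1 [^]\<^bsub>quat\<^esub> m \<otimes>\<^bsub>quat\<^esub> q)"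
      using e assms(2) by (simp only: nat_pow_Suc2 m_assoc nat_pow_closed)
    then show ?case
      using octahedral_polar_45_closed[OF Suc.IH] by simp
  qed (use assms in \<open>simp del: quat_simps\<close>)
  then show ?thesis
    unfolding eq .
qed

end

text \<open>The denominator 4 is that of the half-angle of a rotation by
  \<open>n * pi / 2\<close>.\<close>

lemma finite_words_quat:
  fixes n :: int
  assumes "norm k1 = 1" "norm k2 = 1" "orthogonal k1 k2"
  shows "finite (words quat {quat_polar (of_int n * pi / 4) k1, quat_polar (of_int n * pi / 4) k2})"
proof (rule finite_subset[OF _ finite_octahedral])
  have "words quat {quat_polar (of_int n * pi / 4) k1, quat_polar (of_int n * pi / 4) k2}
      \<subseteq> octahedral k1 k2 \<inter> carrier quat"
  proof (rule words_subset[OF monoid_quat])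
    show "\<one>\<^bsub>quat\<^esub> \<in> octahedral k1 k2"
      using octahedralI1[of 2 0 0 0 k1 k2] by (simp add: frame_quat_def)
  next
    fix g q assume g: "g \<in> {quat_polar (of_int n * pi / 4) k1, quat_polar (of_int n * pi / 4) k2}"
      and q: "q \<in> octahedral k1 k2 \<inter> carrier quat"
    \<comment> \<open>The second generator is treated with the two axes exchanged.\<close>
    show "g \<otimes>\<^bsub>quat\<^esub> q \<in> octahedral k1 k2"
      using g q octahedral_polar_closed[OF assms, of q n]
        octahedral_polar_closed[OF assms(2,1), of q n] assms(3)
      by (auto simp: octahedral_swap[of k2 k1] orthogonal_commute simp del: quat_simps)
  qed (use assms quat_polar_carrier in auto)
  then show "words quat {quat_polar (of_int n * pi / 4) k1, quat_polar (of_int n * pi / 4) k2} \<subseteq> octahedral k1 k2"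
    by blast
qed

section \<open>Transfer from quaternions to rotations and unitary matrices\<close>

theorem corollary2:
  fixes \<phi> :: real and k1 k2 :: "real^3"
  assumes rational: "\<exists>a\<in>\<rat>. \<phi> = a * pi"
    and unit: "norm k1 = 1" "norm k2 = 1"
    and orth: "orthogonal k1 k2"
  shows
    "(\<phi> \<notin> {real_of_int n * pi / 2 | n. True} \<longrightarrow>
        rotation \<phi> k1 \<otimes>\<^bsub>SO3\<^esub> rotation \<phi> k2 \<in> carrier SO3 \<and>
        (\<exists>\<gamma> k. norm k = 1 \<and> rotation \<phi> k1 \<otimes>\<^bsub>SO3\<^esub> rotation \<phi> k2 = rotation \<gamma> k \<and> \<gamma> / pi \<notin> \<rat>)) \<and>
     (words SO3 {rotation \<phi> k1, rotation \<phi> k2} \<subseteq> carrier SO3 \<and>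
        (infinite (words SO3 {rotation \<phi> k1, rotation \<phi> k2}) \<longleftrightarrow>
           \<phi> \<notin> {real_of_int n * pi / 2 | n. True})) \<and>
     (words SU2 {su2_rotation (\<phi> / 2) k1, su2_rotation (\<phi> / 2) k2} \<subseteq> carrier SU2 \<and>
        (infinite (words SU2 {su2_rotation (\<phi> / 2) k1, su2_rotation (\<phi> / 2) k2}) \<longleftrightarrow>
           \<phi> \<notin> {real_of_int n * pi / 2 | n. True}))"
proof -
  interpret SO3: group SO3 by (rule group_SO3)
  interpret SU2: group SU2 by (rule group_SU2)
  interpret quat: monoid quat by (rule monoid_quat)
  define p where "p = quat_polar (\<phi> / 2) k1"
  define q where "q = quat_polar (\<phi> / 2) k2"
  have carrier: "p \<in> carrier quat" "q \<in> carrier quat"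
    using unit by (auto simp: p_def q_def quat_polar_carrier)
  have SO3: "rotation \<phi> k1 = quat_SO3 p" "rotation \<phi> k2 = quat_SO3 q"
    using unit by (simp_all add: p_def q_def quat_SO3_polar)
  have SU2: "su2_rotation (\<phi> / 2) k1 = quat_SU2 p" "su2_rotation (\<phi> / 2) k2 = quat_SU2 q"
    by (simp_all add: p_def q_def quat_SU2_polar)
  have SO3_carrier: "quat_SO3 p \<in> carrier SO3" "quat_SO3 q \<in> carrier SO3"
    and SU2_carrier: "quat_SU2 p \<in> carrier SU2" "quat_SU2 q \<in> carrier SU2"
    using carrier quat_SO3_hom quat_SU2_hom by (auto simp: hom_def simp del: quat_simps)
  have "quat_SO3 \<one>\<^bsub>quat\<^esub> = \<one>\<^bsub>SO3\<^esub>"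
    by (simp add: quat_SO3_one SO3_def)
  from words_hom_image[OF monoid_quat SO3.monoid_axioms quat_SO3_hom this, of "{p, q}"] carrier
  have words_SO3: "words SO3 {quat_SO3 p, quat_SO3 q} = quat_SO3 ` words quat {p, q}"
    by simp
  have "quat_SU2 \<one>\<^bsub>quat\<^esub> = \<one>\<^bsub>SU2\<^esub>"
    by (simp add: quat_SU2_def SU2_def)
  from words_hom_image[OF monoid_quat SU2.monoid_axioms quat_SU2_hom this, of "{p, q}"] carrier
  have words_SU2: "words SU2 {quat_SU2 p, quat_SU2 q} = quat_SU2 ` words quat {p, q}"
    by simp
  obtain \<theta> k where k: "norm k = 1" and pq: "p \<otimes>\<^bsub>quat\<^esub> q = quat_polar \<theta> k"
    using quat_polar_ex[OF quat.m_closed[OF carrier]] by blast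
  \<comment> \<open>Orthogonality of the axes removes the dot product from the scalar part of
    \<open>p\<close> times \<open>q\<close>.\<close>
  have "cos \<theta> = (cos (\<phi> / 2))\<^sup>2"
    using pq orth by (simp add: p_def q_def quat_polar_def orthogonal_def power2_eq_square)
  then have rel: "cos \<phi> = 2 * cos \<theta> - 1"
    using cos_double_cos[of "\<phi> / 2"] by simp
  have irr: "2 * \<theta> / pi \<notin> \<rat>" if "\<phi> \<notin> {real_of_int n * pi / 2 | n. True}"
  proof
    assume "2 * \<theta> / pi \<in> \<rat>"
    then have "2 * \<theta> / pi / 2 \<in> \<rat>"
      by (rule Rats_divide) simp
    then have "\<theta> / pi \<in> \<rat>"
      by simp
    moreover have "\<phi> / pi \<in> \<rat>"
      using rational by auto
    ultimately show False
      using cos_eq_two_cos_minus_one[OF _ _ rel] that by blast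
  qed
  have prod: "quat_SO3 p \<otimes>\<^bsub>SO3\<^esub> quat_SO3 q = rotation (2 * \<theta>) k"
    using hom_mult[OF quat_SO3_hom carrier] pq quat_SO3_polar[OF k] by simp
  have inf: "infinite (quat_SO3 ` words quat {p, q})" if "\<phi> \<notin> {real_of_int n * pi / 2 | n. True}"
    by (rule infinite_words_quat[OF carrier k pq irr[OF that]])
  have fin: "finite (words quat {p, q})" if "\<phi> \<in> {real_of_int n * pi / 2 | n. True}"
  proof -
    from that obtain n :: int where "\<phi> = of_int n * pi / 2"
      by blast
    then have half: "\<phi> / 2 = of_int n * pi / 4"
      by simp
    show ?thesis
      unfolding p_def q_def half by (rule finite_words_quat[OF unit orth])
  qed
  have inf_SU2: "infinite (quat_SU2 ` words quat {p, q}) \<longleftrightarrow> infinite (words quat {p, q})"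
    by (simp add: finite_image_iff inj_on_subset[OF inj_quat_SU2])
  show ?thesis
    unfolding SO3 SU2
  proof (intro conjI impI)
    show "quat_SO3 p \<otimes>\<^bsub>SO3\<^esub> quat_SO3 q \<in> carrier SO3"
      by (rule SO3.m_closed[OF SO3_carrier])
    show "\<exists>\<gamma> k. norm k = 1 \<and> quat_SO3 p \<otimes>\<^bsub>SO3\<^esub> quat_SO3 q = rotation \<gamma> k \<and> \<gamma> / pi \<notin> \<rat>"
      if "\<phi> \<notin> {real_of_int n * pi / 2 | n. True}"
      by (intro exI[of _ "2 * \<theta>"] exI[of _ k] conjI k prod irr that)
    show "words SO3 {quat_SO3 p, quat_SO3 q} \<subseteq> carrier SO3"
      using words_subset[OF SO3.monoid_axioms, of "{quat_SO3 p, quat_SO3 q}" UNIV] SO3_carrier by auto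
    show "words SU2 {quat_SU2 p, quat_SU2 q} \<subseteq> carrier SU2"
      using words_subset[OF SU2.monoid_axioms, of "{quat_SU2 p, quat_SU2 q}" UNIV] SU2_carrier by auto
    show "infinite (words SO3 {quat_SO3 p, quat_SO3 q}) \<longleftrightarrow> \<phi> \<notin> {real_of_int n * pi / 2 | n. True}"
      unfolding words_SO3 using inf finite_imageI[OF fin, of quat_SO3] by argo
    \<comment> \<open>Finitely many quaternion words would have a finite image in
      \<open>SO3\<close>, so the infinitude shown there also settles \<open>SU2\<close>.\<close>
    show "infinite (words SU2 {quat_SU2 p, quat_SU2 q}) \<longleftrightarrow> \<phi> \<notin> {real_of_int n * pi / 2 | n. True}"
      unfolding words_SU2 inf_SU2 using inf finite_imageI[of "words quat {p, q}" quat_SO3] fin by argo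
  qed
qed

end
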